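(* Let $\rho$ be a state on $M_n(\mathbb{C})$, and define a $q$-positive map $\phi$ on $M_n(\mathbb{C})$ by $\phi(A)=\rho(A)I$. Then $\phi$ is $q$-pure if and only if $\rho$ is faithful.
   Context: For linear maps, $I$ also denotes the identity map. A linear map $\phi:M_n(\mathbb{C})\to M_n(\mathbb{C})$ is $q$-positive if it has no negative eigenvalues and $\phi(I+t\phi)^{-1}$ is completely positive for all $t\ge0$. For $q$-positive $\phi,\psi$ on $M_n(\mathbb{C})$, $\psi$ is a $q$-subordinate of $\phi$ (written $\phi\ge_q\psi$) if $\phi(I+t\phi)^{-1}-\psi(I+t\psi)^{-1}$ is completely positive for all $t\ge0$. For $s\ge0$ let $\phi^{(s)}=\phi(I+s\phi)^{-1}$. A unital $q$-positive map $\phi$ is $q$-pure if its set of $q$-subordinates is precisely $\{0\}\cup\{\phi^{(s)}\}_{s\ge0}$. *)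

theory Defs
  imports "HOL-Analysis.Analysis"
begin

text \<open>
  The matrix algebra is the type \<^typ>\<open>complex^'n^'n\<close>; its unit is \<^term>\<open>mat 1\<close>.
  The library scales such matrices by real numbers only, whence the following operation.
\<close>

definition cscale :: "complex \<Rightarrow> complex^'n^'n \<Rightarrow> complex^'n^'n"  (infixr "*\<^sub>C" 75)
  where "c *\<^sub>C A = (\<chi> i. c *s (A $ i))"

lemma vector_space_cscale: "vector_space cscale"
  by unfold_locales (simp_all add: cscale_def vec_eq_iff algebra_simps)

abbreviation matrix_map_linear :: "(complex^'n^'n \<Rightarrow> complex^'n^'n) \<Rightarrow> bool"
  where "matrix_map_linear \<equiv> Vector_Spaces.linear cscale cscale"

definition cinner :: "complex^'n \<Rightarrow> complex^'n \<Rightarrow> complex"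
  where "cinner v w = (\<Sum>i\<in>UNIV. cnj (v $ i) * w $ i)"

definition positive_matrix :: "complex^'n^'n \<Rightarrow> bool"
  where "positive_matrix A \<longleftrightarrow> (\<forall>v. cinner v (A *v v) \<in> \<real>\<^sub>\<ge>\<^sub>0)"

text \<open>
  A \<open>k \<times> k\<close> matrix \<open>B\<close> over the matrix algebra is given by its entries \<open>B i j\<close> with
  \<open>i, j < k\<close>. It is positive if it is so as an operator on the direct sum of \<open>k\<close> copies of
  \<^typ>\<open>complex^'n\<close>, whose elements are the families \<open>v 0, \<dots>, v (k - 1)\<close>.
\<close>

definition positive_block_matrix :: "nat \<Rightarrow> (nat \<Rightarrow> nat \<Rightarrow> complex^'n^'n) \<Rightarrow> bool"
  where "positive_block_matrix k B \<longleftrightarrow>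
    (\<forall>v :: nat \<Rightarrow> complex^'n. (\<Sum>i<k. cinner (v i) (\<Sum>j<k. B i j *v v j)) \<in> \<real>\<^sub>\<ge>\<^sub>0)"

definition completely_positive :: "(complex^'n^'n \<Rightarrow> complex^'n^'n) \<Rightarrow> bool"
  where "completely_positive \<phi> \<longleftrightarrow> matrix_map_linear \<phi> \<and>
    (\<forall>k B. positive_block_matrix k B \<longrightarrow> positive_block_matrix k (\<lambda>i j. \<phi> (B i j)))"

definition matrix_map_eigenvalue :: "(complex^'n^'n \<Rightarrow> complex^'n^'n) \<Rightarrow> complex \<Rightarrow> bool"
  where "matrix_map_eigenvalue \<phi> c \<longleftrightarrow> (\<exists>A. A \<noteq> 0 \<and> \<phi> A = c *\<^sub>C A)"

text \<open>
  The map \<open>\<phi> (I + t \<phi>)\<inverse>\<close>. For \<open>t \<ge> 0\<close> the function inverse is a genuine two-sided inverse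
  whenever \<open>\<phi>\<close> is linear without negative eigenvalues, and it is only used for such maps.
\<close>

definition resolvent_map ::
    "real \<Rightarrow> (complex^'n^'n \<Rightarrow> complex^'n^'n) \<Rightarrow> complex^'n^'n \<Rightarrow> complex^'n^'n"
  where "resolvent_map t \<phi> = \<phi> \<circ> inv (\<lambda>A. A + t *\<^sub>R \<phi> A)"

definition q_positive :: "(complex^'n^'n \<Rightarrow> complex^'n^'n) \<Rightarrow> bool"
  where "q_positive \<phi> \<longleftrightarrow> matrix_map_linear \<phi> \<and>
    (\<nexists>r::real. r < 0 \<and> matrix_map_eigenvalue \<phi> (complex_of_real r)) \<and>
    (\<forall>t\<ge>0. completely_positive (resolvent_map t \<phi>))"

definition q_subordinate ::
    "(complex^'n^'n \<Rightarrow> complex^'n^'n) \<Rightarrow> (complex^'n^'n \<Rightarrow> complex^'n^'n) \<Rightarrow> bool"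
    (infix "\<ge>\<^sub>q" 50)
  where "\<phi> \<ge>\<^sub>q \<psi> \<longleftrightarrow> q_positive \<phi> \<and> q_positive \<psi> \<and>
    (\<forall>t\<ge>0. completely_positive (\<lambda>A. resolvent_map t \<phi> A - resolvent_map t \<psi> A))"

definition q_pure :: "(complex^'n^'n \<Rightarrow> complex^'n^'n) \<Rightarrow> bool"
  where "q_pure \<phi> \<longleftrightarrow> \<phi> (mat 1) = mat 1 \<and> q_positive \<phi> \<and>
    {\<psi>. \<phi> \<ge>\<^sub>q \<psi>} = {\<lambda>A. 0} \<union> {resolvent_map s \<phi> | s. s \<ge> 0}"

definition state :: "(complex^'n^'n \<Rightarrow> complex) \<Rightarrow> bool"
  where "state \<rho> \<longleftrightarrow> Vector_Spaces.linear cscale (*) \<rho> \<and>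
    (\<forall>A. positive_matrix A \<longrightarrow> \<rho> A \<in> \<real>\<^sub>\<ge>\<^sub>0) \<and> \<rho> (mat 1) = 1"

definition faithful :: "(complex^'n^'n \<Rightarrow> complex) \<Rightarrow> bool"
  where "faithful \<rho> \<longleftrightarrow> (\<forall>A. positive_matrix A \<and> \<rho> A = 0 \<longrightarrow> A = 0)"

end

theory Submission
  imports Defs
begin

text \<open>
  Write \<open>\<phi>\<close> for the map \<open>A \<mapsto> \<rho>(A) I\<close>. For a positive functional \<open>\<rho>\<close> and a positive matrix \<open>Q\<close>,
  the map \<open>\<rho>(\<cdot>) Q\<close> has the resolvent \<open>\<rho>(\<cdot>) Q / (1 + t \<rho>(Q))\<close>, so everything about such maps can
  be read off from scalars; in particular the \<open>\<phi>\<^sup>(\<^sup>s\<^sup>)\<close> together with \<open>0\<close> are exactly the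
  multiples \<open>d \<phi>\<close> with \<open>0 \<le> d \<le> 1\<close>, and these are always \<open>q\<close>-subordinates of \<open>\<phi>\<close>
  (\<open>state_multiples_eq\<close>, \<open>state_multiple_subordinate\<close>). What has to be decided is whether there
  are other subordinates.

  If \<open>\<rho>\<close> is not faithful, it vanishes on a positive \<open>A \<noteq> 0\<close>, hence on some rank one matrix below
  a multiple of \<open>A\<close>, hence on a rank one projection \<open>P\<close>. Then \<open>\<rho>(I - P) = 1\<close>, so that
  \<open>\<psi> = \<rho>(\<cdot>) (I - P)\<close> satisfies \<open>\<phi>\<^sup>(\<^sup>t\<^sup>) - \<psi>\<^sup>(\<^sup>t\<^sup>) = \<rho>(\<cdot>) P / (1 + t)\<close>: it is a
  subordinate, and no multiple of \<open>\<phi>\<close> (\<open>not_faithful_subordinate\<close>).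

  Let \<open>\<rho>\<close> be faithful and \<open>\<psi>\<close> a subordinate (\<open>faithful_subordinate\<close>). The maps
  \<open>L\<^sub>t = t \<psi>\<^sup>(\<^sup>t\<^sup>) = I - (I + t \<psi>)\<inverse>\<close> are positive, lie below \<open>\<phi>\<close>, commute with \<open>\<psi>\<close>, and tend to
  the identity on the range of \<open>\<psi>\<close>. By compactness \<open>L\<^sub>t I\<close> accumulates at some \<open>M\<close> with
  \<open>0 \<le> M \<le> I\<close>, which lies in the range of \<open>\<psi>\<close>, so \<open>L\<^sub>t M \<rightarrow> M\<close>. Passing to the limit in
  \<open>L\<^sub>t M \<le> \<rho>(M) I\<close> and applying \<open>L\<^sub>t\<close> once more gives \<open>M \<le> \<rho>(M) M\<close>. Hence \<open>M = 0\<close> or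
  \<open>\<rho>(I - M) \<le> 0\<close>, and in the second case faithfulness yields \<open>M = I\<close>. A sequence of positive
  maps tends to \<open>0\<close> as soon as its values at \<open>I\<close> do (\<open>positive_maps_tendsto_0\<close>). So if
  \<open>M = 0\<close>, then \<open>L\<^sub>t \<rightarrow> 0\<close> and \<open>\<psi> = 0\<close>; if \<open>M = I\<close>, then \<open>\<phi> - L\<^sub>t \<rightarrow> 0\<close>, so \<open>\<phi>\<close> is the identity on
  the range of \<open>\<psi>\<close> and commutes with \<open>\<psi>\<close>, which makes \<open>\<psi>\<close> a multiple of \<open>\<phi>\<close>.
\<close>

section \<open>Sesquilinear forms\<close>

definition form :: "complex^'n^'n \<Rightarrow> complex^'n \<Rightarrow> complex^'n \<Rightarrow> complex"
  where "form A u v = cinner u (A *v v)"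

lemma cscale_nth: "(c *\<^sub>C A) $ i $ j = c * A $ i $ j"
  by (simp add: cscale_def)

lemma scaleR_eq_cscale: "r *\<^sub>R (A :: complex^'n^'n) = complex_of_real r *\<^sub>C A"
  by (simp add: vec_eq_iff cscale_nth scaleR_conv_of_real[where 'a = complex])

lemma cscale_simps:
  fixes A B :: "complex^'n^'n"
  shows "c *\<^sub>C (A + B) = c *\<^sub>C A + c *\<^sub>C B" "c *\<^sub>C (A - B) = c *\<^sub>C A - c *\<^sub>C B"
    "(c + d) *\<^sub>C A = c *\<^sub>C A + d *\<^sub>C A" "(c - d) *\<^sub>C A = c *\<^sub>C A - d *\<^sub>C A"
    "c *\<^sub>C d *\<^sub>C A = (c * d) *\<^sub>C A" "1 *\<^sub>C A = A" "0 *\<^sub>C A = 0" "c *\<^sub>C (0 :: complex^'n^'n) = 0"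
  by (simp_all add: vec_eq_iff cscale_nth algebra_simps)

lemma cscale_minus_1: "(- 1) *\<^sub>C A = - A"
  by (simp add: vec_eq_iff cscale_nth)

lemma cinner_add_left: "cinner (u + u') v = cinner u v + cinner u' v"
  and cinner_add_right: "cinner u (v + v') = cinner u v + cinner u v'"
  and cinner_diff_left: "cinner (u - u') v = cinner u v - cinner u' v"
  and cinner_diff_right: "cinner u (v - v') = cinner u v - cinner u v'"
  and cinner_scale_left: "cinner (c *s u) v = cnj c * cinner u v"
  and cinner_scale_right: "cinner u (c *s v) = c * cinner u v"
  and cinner_sum_right: "cinner u (sum f S) = (\<Sum>i\<in>S. cinner u (f i))"
  and cinner_zero_right: "cinner u 0 = 0"
  by (simp_all add: cinner_def algebra_simps sum.distrib sum_subtractf sum_distrib_left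
      sum_distrib_right sum.swap[of _ S])

lemma cnj_cinner: "cnj (cinner u v) = cinner v u"
  by (simp add: cinner_def mult.commute)

lemma cinner_self: "cinner v v = complex_of_real (\<Sum>i\<in>UNIV. (cmod (v $ i))\<^sup>2)"
  by (simp add: cinner_def complex_norm_square mult.commute del: of_real_power)

lemma cinner_self_eq_0: "cinner v v = 0 \<longleftrightarrow> v = 0"
  unfolding cinner_self of_real_eq_0_iff by (simp add: sum_nonneg_eq_0_iff vec_eq_iff)

lemma cinner_axis_left: "cinner (axis i 1) v = v $ i"
  by (simp add: cinner_def axis_def if_distrib if_distribR cong: if_cong)

lemma cscale_mult_vec: "(c *\<^sub>C A) *v v = c *s (A *v v)"
  by (simp add: vec_eq_iff matrix_vector_mult_def cscale_nth sum_distrib_left mult.assoc)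

lemma form_simps:
  "form (A + B) u v = form A u v + form B u v" "form (A - B) u v = form A u v - form B u v"
  "form (c *\<^sub>C A) u v = c * form A u v" "form 0 u v = 0"
  "form A (u + u') v = form A u v + form A u' v" "form A (u - u') v = form A u v - form A u' v"
  "form A u (v + v') = form A u v + form A u v'" "form A u (v - v') = form A u v - form A u v'"
  "form A (c *s u) v = cnj c * form A u v" "form A u (c *s v) = c * form A u v"
  "form (mat 1) u v = cinner u v"
  by (simp_all add: form_def cinner_add_left cinner_add_right cinner_diff_left cinner_diff_right
      cinner_scale_left cinner_scale_right cinner_zero_right cscale_mult_vec
      matrix_vector_mult_add_rdistrib matrix_vector_mult_diff_rdistrib
      matrix_vector_right_distrib matrix_vector_mult_diff_distrib vector_scalar_commute)

lemma form_axis: "form A (axis i 1) (axis j 1) = A $ i $ j"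
  unfolding form_def cinner_axis_left
  by (simp add: matrix_vector_mult_def axis_def if_distrib if_distribR cong: if_cong)

text \<open>
  Polarization reduces questions about entries (positivity, bounds, limits) to the quadratic form.
\<close>

lemma form_polarization:
  "form A u v = (form A (u + v) (u + v) - form A (u - v) (u - v)
     - \<i> * form A (u + \<i> *s v) (u + \<i> *s v) + \<i> * form A (u - \<i> *s v) (u - \<i> *s v)) / 4"
  by (simp add: form_simps algebra_simps)

lemma positive_matrix_form: "positive_matrix A \<longleftrightarrow> (\<forall>v. form A v v \<in> \<real>\<^sub>\<ge>\<^sub>0)"
  by (simp add: positive_matrix_def form_def)

lemma matrix_eq_0_if_form:
  assumes "\<And>v. form A v v = 0" shows "A = 0"
  using form_polarization[of A] form_axis[of A] assms by (simp add: vec_eq_iff)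

section \<open>Rank one matrices\<close>

definition rank_one :: "complex^'n \<Rightarrow> complex^'n \<Rightarrow> complex^'n^'n"
  where "rank_one v w = (\<chi> i j. v $ i * cnj (w $ j))"

lemma rank_one_mult_vec: "rank_one x y *v v = cinner y v *s x"
  by (simp add: vec_eq_iff rank_one_def matrix_vector_mult_def cinner_def sum_distrib_left mult_ac)

lemma form_rank_one: "form (rank_one x y) u v = cinner u x * cinner y v"
  by (simp add: form_def rank_one_mult_vec cinner_scale_right)

lemma nonneg_Reals_mult_cnj: "z * cnj z \<in> \<real>\<^sub>\<ge>\<^sub>0"
  by (simp add: complex_nonneg_Reals_iff)

lemma positive_rank_one: "positive_matrix (rank_one w w)"
  unfolding positive_matrix_form form_rank_one
  by (metis nonneg_Reals_mult_cnj cnj_cinner)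

lemma rank_one_polarization:
  "rank_one u v = (1/4) *\<^sub>C (rank_one (u + v) (u + v) - rank_one (u - v) (u - v)
     + \<i> *\<^sub>C rank_one (u + \<i> *s v) (u + \<i> *s v) - \<i> *\<^sub>C rank_one (u - \<i> *s v) (u - \<i> *s v))"
  by (simp add: vec_eq_iff cscale_nth rank_one_def algebra_simps)

text \<open>
  The matrices \<open>w w\<^sup>*\<close> span the matrix algebra: matrix units are \<open>e\<^sub>i e\<^sub>j\<^sup>*\<close>, and polarization
  handles \<open>u v\<^sup>*\<close>. Hence a property that is stable under linear combinations has to be checked on
  positive matrices of rank one only.
\<close>

lemma matrix_induct_rank_one [case_names rank_one add scale]:
  fixes A :: "complex^'n^'n"
  assumes rank_one: "\<And>w. P (rank_one w w)"
    and add: "\<And>A B. P A \<Longrightarrow> P B \<Longrightarrow> P (A + B)"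
    and scale: "\<And>c A. P A \<Longrightarrow> P (c *\<^sub>C A)"
  shows "P A"
proof -
  have diff: "P (A - B)" if "P A" "P B" for A B
    using add[OF that(1) scale[OF that(2), of "-1"]]
    by (simp add: cscale_minus_1)
  have r: "P (rank_one u v)" for u v
    by (subst rank_one_polarization) (intro add diff scale rank_one)
  have 0: "P 0" using scale[OF r, of 0] by (simp add: cscale_simps)
  have s: "P (sum f S)" if "\<And>i. P (f i)" for f :: "'n \<Rightarrow> complex^'n^'n" and S
    using that by (induction S rule: infinite_finite_induct) (auto intro: 0 add)
  have A: "A = (\<Sum>i\<in>UNIV. \<Sum>j\<in>UNIV. A $ i $ j *\<^sub>C rank_one (axis i 1) (axis j 1))"
  proof -
    have "(\<Sum>i\<in>UNIV. \<Sum>j\<in>UNIV. (A $ i $ j *\<^sub>C rank_one (axis i 1) (axis j 1)) $ k $ l)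
        = (\<Sum>i\<in>UNIV. if i = k then \<Sum>j\<in>UNIV. if j = l then A $ i $ j else 0 else 0)" for k l
      by (intro sum.cong refl) (auto simp: cscale_nth rank_one_def axis_def if_distrib[of cnj]
          if_distrib[of "(*) c" for c] cong: if_cong)
    then show ?thesis by (simp add: vec_eq_iff)
  qed
  show ?thesis by (subst A) (intro s scale r)
qed

section \<open>The order on matrices\<close>

lemma positive_mat_1: "positive_matrix (mat 1)"
  by (auto simp: positive_matrix_form form_simps cinner_self complex_nonneg_Reals_iff intro: sum_nonneg)

lemma positive_matrix_add:
  assumes "positive_matrix A" "positive_matrix B"
  shows "positive_matrix (A + B)"
  using assms by (simp add: positive_matrix_form form_simps)

lemma positive_matrix_scale:
  assumes "positive_matrix A" "c \<in> \<real>\<^sub>\<ge>\<^sub>0"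
  shows "positive_matrix (c *\<^sub>C A)"
  using assms by (simp add: positive_matrix_form form_simps)

text \<open>
  The quadratic form of \<open>A - A\<^sup>*\<close> vanishes because that of \<open>A\<close> is real.
\<close>

lemma form_hermitian:
  assumes "positive_matrix A"
  shows "form A v u = cnj (form A u v)"
proof -
  define B where "B = (\<chi> i j. cnj (A $ j $ i))"
  have B: "form B u v = cnj (form A v u)" for u v
    unfolding form_def cinner_def matrix_vector_mult_def B_def
    by (simp add: sum_distrib_left, subst sum.swap, simp add: algebra_simps)
  have "A - B = 0"
  proof (rule matrix_eq_0_if_form)
    fix v
    have "form A v v \<in> \<real>\<^sub>\<ge>\<^sub>0" using assms by (simp add: positive_matrix_form)
    then show "form (A - B) v v = 0"
      by (simp add: form_simps B complex_nonneg_Reals_iff complex_eq_iff)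
  qed
  then show ?thesis using B[of v u] by simp
qed

text \<open>
  The Cauchy--Schwarz inequality for the semi-inner product given by \<open>A\<close>. It puts a multiple of a
  rank one matrix below every nonzero positive matrix.
\<close>

lemma rank_one_le:
  assumes A: "positive_matrix A" and nz: "form A v v \<noteq> 0"
  shows "positive_matrix (form A v v *\<^sub>C A - rank_one (A *v v) (A *v v))"
  unfolding positive_matrix_form
proof
  fix u
  define a b where "a = form A v v" and "b = form A u v"
  have cb: "form A v u = cnj b" unfolding b_def using form_hermitian[OF A] .
  have a: "Re a \<ge> 0" "Im a = 0" "cnj a = a" "a \<noteq> 0"
    using A nz by (auto simp: a_def positive_matrix_form complex_nonneg_Reals_iff complex_eq_iff)
  have "cinner u (A *v v) = b" "cinner (A *v v) u = cnj b"
    using cnj_cinner[of u "A *v v"] by (simp_all add: b_def form_def)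
  then have q: "form (a *\<^sub>C A - rank_one (A *v v) (A *v v)) u u = a * form A u u - b * cnj b"
    by (simp add: form_simps form_rank_one)
  \<comment> \<open>The vector is \<open>a\<close> times the component of \<open>u\<close> that is \<open>A\<close>-orthogonal to \<open>v\<close>.\<close>
  have "form A (a *s u - cnj b *s v) (a *s u - cnj b *s v) = a * (a * form A u u - b * cnj b)"
    using cb by (simp add: form_simps a a_def[symmetric] b_def[symmetric] algebra_simps)
  then have "a * (a * form A u u - b * cnj b) \<in> \<real>\<^sub>\<ge>\<^sub>0"
    using A by (metis positive_matrix_form)
  then show "form (form A v v *\<^sub>C A - rank_one (A *v v) (A *v v)) u u \<in> \<real>\<^sub>\<ge>\<^sub>0"
    unfolding a_def[symmetric] q
    using a by (auto simp: complex_nonneg_Reals_iff complex_eq_iff zero_le_mult_iff)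
qed

lemma rank_one_le_mat_1: "positive_matrix (cinner w w *\<^sub>C mat 1 - rank_one w w)"
proof (cases "w = 0")
  case True
  then have "cinner w w *\<^sub>C mat 1 - rank_one w w = 0"
    by (simp add: cinner_def rank_one_def vec_eq_iff cscale_nth)
  then show ?thesis by (simp add: positive_matrix_form form_simps)
next
  case False
  then show ?thesis
    using rank_one_le[OF positive_mat_1, of w] by (simp add: form_simps cinner_self_eq_0)
qed

lemma form_cmod_polarization:
  assumes "\<And>w. cmod (form A w w) \<le> a * Re (cinner w w)"
  shows "cmod (form A u v) \<le> a * (Re (cinner u u) + Re (cinner v v))"
proof -
  have parallelogram: "Re (cinner (u + v) (u + v)) + Re (cinner (u - v) (u - v))
      + Re (cinner (u + \<i> *s v) (u + \<i> *s v)) + Re (cinner (u - \<i> *s v) (u - \<i> *s v))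
      = 4 * (Re (cinner u u) + Re (cinner v v))"
    by (simp add: cinner_add_left cinner_add_right cinner_diff_left cinner_diff_right
      cinner_scale_left cinner_scale_right)
  have "cmod (form A u v) \<le> (cmod (form A (u + v) (u + v)) + cmod (form A (u - v) (u - v))
     + cmod (form A (u + \<i> *s v) (u + \<i> *s v)) + cmod (form A (u - \<i> *s v) (u - \<i> *s v))) / 4"
  proof -
    have "cmod (p - q - \<i> * r + \<i> * s) \<le> cmod p + cmod q + cmod r + cmod s" for p q r s
      using norm_triangle_ineq[of "p - q - \<i> * r" "\<i> * s"] norm_triangle_ineq4[of "p - q" "\<i> * r"]
        norm_triangle_ineq4[of p q] by (simp add: norm_mult)
    then show ?thesis
      unfolding form_polarization[of A u v] norm_divide by (simp add: divide_right_mono)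
  qed
  also have "\<dots> \<le> (a * Re (cinner (u + v) (u + v)) + a * Re (cinner (u - v) (u - v))
      + a * Re (cinner (u + \<i> *s v) (u + \<i> *s v)) + a * Re (cinner (u - \<i> *s v) (u - \<i> *s v))) / 4"
    by (intro divide_right_mono add_mono assms) simp
  also have "\<dots> = a * (Re (cinner u u) + Re (cinner v v))"
    by (simp only: distrib_left[symmetric] parallelogram)
  finally show ?thesis .
qed

lemma norm_matrix_le_entries: "norm A \<le> (\<Sum>i\<in>UNIV. \<Sum>j\<in>UNIV. cmod (A $ i $ j))"
  for A :: "complex^'n^'n"
proof -
  have l1: "norm v \<le> (\<Sum>i\<in>UNIV. norm (v $ i))" for v :: "'b::real_normed_vector ^'n"
    unfolding norm_vec_def by (rule L2_set_le_sum) simp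
  show ?thesis
    by (rule order_trans[OF l1]) (intro sum_mono l1)
qed

text \<open>
  The order interval from \<open>0\<close> to \<open>I\<close> is bounded, so sequences in it have convergent subsequences.
  The constant comes from bounding each entry by polarization.
\<close>

lemma norm_le_if_le_mat_1:
  fixes A :: "complex^'n^'n"
  assumes "positive_matrix A" "positive_matrix (mat 1 - A)"
  shows "norm A \<le> 2 * real CARD('n) ^ 2"
proof -
  have w: "cmod (form A w w) \<le> 1 * Re (cinner w w)" for w
  proof -
    have "form A w w \<in> \<real>\<^sub>\<ge>\<^sub>0" "cinner w w - form A w w \<in> \<real>\<^sub>\<ge>\<^sub>0"
      using assms by (auto simp: positive_matrix_form form_simps)
    then show ?thesis by (simp add: complex_nonneg_Reals_iff cmod_eq_Re)
  qed
  have "cmod (A $ i $ j) \<le> 2" for i j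
    using form_cmod_polarization[of A 1, OF w, of "axis i 1" "axis j 1"]
    by (simp add: form_axis cinner_axis_left)
  then have "(\<Sum>i\<in>UNIV. \<Sum>j\<in>UNIV. cmod (A $ i $ j)) \<le> (\<Sum>i\<in>(UNIV::'n set). \<Sum>j\<in>(UNIV::'n set). 2)"
    by (intro sum_mono) auto
  with norm_matrix_le_entries[of A] show ?thesis
    by (simp add: power2_eq_square)
qed

lemma form_tendsto:
  fixes X :: "'b \<Rightarrow> complex^'n^'n"
  assumes "(X \<longlongrightarrow> A) F"
  shows "((\<lambda>k. form (X k) u v) \<longlongrightarrow> form A u v) F"
  unfolding form_def cinner_def matrix_vector_mult_def
  by (simp, intro tendsto_intros assms)

lemma tendsto_cscale:
  fixes X :: "'b \<Rightarrow> complex^'n^'n"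
  assumes "(X \<longlongrightarrow> A) F"
  shows "((\<lambda>k. c *\<^sub>C X k) \<longlongrightarrow> c *\<^sub>C A) F"
  unfolding cscale_def vector_scalar_mult_def by (intro tendsto_intros assms)

lemma positive_matrix_tendsto:
  assumes "X \<longlonglongrightarrow> A" "\<And>k. positive_matrix (X k)"
  shows "positive_matrix A"
  unfolding positive_matrix_form
proof
  fix v
  show "form A v v \<in> \<real>\<^sub>\<ge>\<^sub>0"
    using assms by (intro closed_sequentially[OF closed_nonneg_Reals_complex _ form_tendsto[OF assms(1)]])
      (simp add: positive_matrix_form)
qed

lemma positive_squeeze:
  assumes "\<And>k. positive_matrix (X k)" "\<And>k. positive_matrix (Y k - X k)" "Y \<longlonglongrightarrow> 0"
  shows "X \<longlonglongrightarrow> 0"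
proof -
  have q: "(\<lambda>k. form (X k) w w) \<longlonglongrightarrow> 0" for w
  proof (rule Lim_null_comparison)
    show "(\<lambda>k. Re (form (Y k) w w)) \<longlonglongrightarrow> 0"
      using tendsto_Re[OF form_tendsto[OF assms(3)], of w w] by (simp add: form_simps)
    have "form (X k) w w \<in> \<real>\<^sub>\<ge>\<^sub>0" "form (Y k) w w - form (X k) w w \<in> \<real>\<^sub>\<ge>\<^sub>0" for k
      using assms by (auto simp: positive_matrix_form form_simps)
    then show "\<forall>\<^sub>F k in sequentially. cmod (form (X k) w w) \<le> Re (form (Y k) w w)"
      by (simp add: complex_nonneg_Reals_iff cmod_eq_Re)
  qed
  have "(\<lambda>k. form (X k) u v) \<longlonglongrightarrow> (0 - 0 - \<i> * 0 + \<i> * 0) / 4" for u v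
    unfolding form_polarization[of _ u v] by (intro tendsto_intros q) simp
  then show ?thesis
    unfolding form_axis[symmetric]
    by (intro vec_tendstoI) (simp add: form_axis[symmetric])
qed

section \<open>Positive maps\<close>

lemma matrix_map_linear_iff:
  "matrix_map_linear F \<longleftrightarrow> (\<forall>A B. F (A + B) = F A + F B) \<and> (\<forall>c A. F (c *\<^sub>C A) = c *\<^sub>C F A)"
  by (simp add: Vector_Spaces.linear_iff vector_space_cscale)

lemma matrix_map_linear_imp_linear: "matrix_map_linear F \<Longrightarrow> linear F"
  by (auto intro!: linearI simp: matrix_map_linear_iff scaleR_eq_cscale)

lemma matrix_functional_linear_iff:
  "Vector_Spaces.linear cscale (*) \<rho> \<longleftrightarrow>
    (\<forall>A B. \<rho> (A + B) = \<rho> A + \<rho> B) \<and> (\<forall>c A. \<rho> (c *\<^sub>C A) = c * \<rho> A)"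
  by (simp add: Vector_Spaces.linear_iff vector_space_cscale vector_space_over_itself.vector_space_axioms)

definition positive_map :: "(complex^'n^'n \<Rightarrow> complex^'n^'n) \<Rightarrow> bool"
  where "positive_map F \<longleftrightarrow> matrix_map_linear F \<and> (\<forall>A. positive_matrix A \<longrightarrow> positive_matrix (F A))"

lemma completely_positive_imp_positive:
  fixes F :: "complex^'n^'n \<Rightarrow> complex^'n^'n"
  assumes "completely_positive F"
  shows "positive_map F"
proof -
  have "positive_block_matrix 1 (\<lambda>i j. A) \<longleftrightarrow> positive_matrix A" for A :: "complex^'n^'n"
    unfolding positive_block_matrix_def positive_matrix_def by (auto dest: spec[of _ "\<lambda>_. _"])
  then have "positive_matrix (F A)" if "positive_matrix A" for A
    using assms that unfolding completely_positive_def
    by blast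
  then show ?thesis
    using assms by (simp add: completely_positive_def positive_map_def)
qed

lemma positive_map_mono:
  assumes "positive_map F" "positive_matrix (B - A)"
  shows "positive_matrix (F B - F A)"
  using assms linear_diff[OF matrix_map_linear_imp_linear] unfolding positive_map_def by metis

text \<open>
  Positive maps are controlled by their value at \<open>I\<close>: since \<open>w w\<^sup>* \<le> \<langle>w, w\<rangle> I\<close>, the image of
  \<open>w w\<^sup>*\<close> is squeezed between \<open>0\<close> and a multiple of that value.
\<close>

lemma positive_maps_tendsto_0:
  assumes F: "\<And>k. positive_map (F k)" and 1: "(\<lambda>k. F k (mat 1)) \<longlonglongrightarrow> 0"
  shows "(\<lambda>k. F k A) \<longlonglongrightarrow> 0"
proof -
  have lin: "matrix_map_linear (F k)" for k using F by (simp add: positive_map_def)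
  show ?thesis
  proof (induction A rule: matrix_induct_rank_one)
    case (rank_one w)
    show ?case
    proof (rule positive_squeeze)
      show "positive_matrix (F k (rank_one w w))" for k
        using F by (simp add: positive_map_def positive_rank_one)
      show "positive_matrix (F k (cinner w w *\<^sub>C mat 1) - F k (rank_one w w))" for k
        using positive_map_mono[OF F rank_one_le_mat_1] .
      show "(\<lambda>k. F k (cinner w w *\<^sub>C mat 1)) \<longlonglongrightarrow> 0"
        using tendsto_cscale[OF 1, of "cinner w w"] lin by (simp add: matrix_map_linear_iff cscale_simps)
    qed
  next
    case (add A B)
    then show ?case using tendsto_add[OF add] lin by (simp add: matrix_map_linear_iff)
  next
    case (scale c A)
    then show ?case using tendsto_cscale[OF scale, of c] lin by (simp add: matrix_map_linear_iff cscale_simps)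
  qed
qed

section \<open>Positive functionals\<close>

definition positive_functional :: "(complex^'n^'n \<Rightarrow> complex) \<Rightarrow> bool"
  where "positive_functional \<rho> \<longleftrightarrow> Vector_Spaces.linear cscale (*) \<rho> \<and>
    (\<forall>A. positive_matrix A \<longrightarrow> \<rho> A \<in> \<real>\<^sub>\<ge>\<^sub>0)"

lemma positive_functional_linear:
  assumes "positive_functional \<rho>"
  shows "\<rho> (A + B) = \<rho> A + \<rho> B" "\<rho> (c *\<^sub>C A) = c * \<rho> A" "\<rho> (A - B) = \<rho> A - \<rho> B" "\<rho> 0 = 0"
proof -
  show *: "\<rho> (A + B) = \<rho> A + \<rho> B" "\<rho> (c *\<^sub>C A) = c * \<rho> A" for A B c
    using assms by (auto simp: positive_functional_def matrix_functional_linear_iff)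
  show "\<rho> (A - B) = \<rho> A - \<rho> B" using *(1)[of "A - B" B] by simp
  show "\<rho> 0 = 0" using *(2)[of 0] by (simp add: cscale_simps)
qed

lemma positive_functional_scale:
  assumes "positive_functional \<rho>" "d \<ge> 0"
  shows "positive_functional (\<lambda>A. complex_of_real d * \<rho> A)"
  using assms unfolding positive_functional_def matrix_functional_linear_iff
  by (auto simp: algebra_simps)

text \<open>
  Given the factorization \<open>Q = T\<^sup>* T\<close>, the block form of \<open>\<rho>(B\<^sub>i\<^sub>j) Q\<close> at \<open>v\<close> splits along the coordinates
  \<open>l\<close> into the values of \<open>\<rho>\<close> at the compressions \<open>\<Sum>\<^sub>i\<^sub>j cnj (x\<^sub>i) x\<^sub>j B\<^sub>i\<^sub>j\<close> of \<open>B\<close>, where \<open>x\<^sub>i\<close> is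
  coordinate \<open>l\<close> of \<open>T v\<^sub>i\<close>; these are positive. The identity and orthogonal projections factor
  as their own squares.
\<close>

lemma completely_positive_functional:
  fixes Q T :: "complex^'n^'n"
  assumes \<rho>: "positive_functional \<rho>"
    and Q: "\<And>u v. form Q u v = cinner (T *v u) (T *v v)"
  shows "completely_positive (\<lambda>A. \<rho> A *\<^sub>C Q)"
proof -
  note lin = positive_functional_linear[OF \<rho>]
  have \<rho>sum: "\<rho> (sum f S) = (\<Sum>i\<in>S. \<rho> (f i))" for f :: "nat \<Rightarrow> _" and S
    by (induction S rule: infinite_finite_induct) (auto simp: lin)
  have fsum: "form (sum f S) u v = (\<Sum>i\<in>S. form (f i) u v)" for f :: "nat \<Rightarrow> complex^'n^'n" and S u v
    by (induction S rule: infinite_finite_induct) (auto simp: form_simps)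
  have nn: "sum f S \<in> \<real>\<^sub>\<ge>\<^sub>0" if "\<And>i. f i \<in> \<real>\<^sub>\<ge>\<^sub>0" for f :: "'n \<Rightarrow> complex" and S
    using that by (induction S rule: infinite_finite_induct) auto
  have "positive_block_matrix k (\<lambda>i j. \<rho> (B i j) *\<^sub>C Q)" if B: "positive_block_matrix k B" for k B
    unfolding positive_block_matrix_def
  proof
    fix v :: "nat \<Rightarrow> complex^'n"
    define C where "C l = (\<Sum>i<k. \<Sum>j<k. (cnj ((T *v v i) $ l) * (T *v v j) $ l) *\<^sub>C B i j)" for l
    have "positive_matrix (C l)" for l
      unfolding positive_matrix_form
    proof
      fix u
      have "form (C l) u u = (\<Sum>i<k. cinner ((T *v v i) $ l *s u) (\<Sum>j<k. B i j *v ((T *v v j) $ l *s u)))"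
        unfolding C_def fsum cinner_sum_right form_def[symmetric] by (simp add: form_simps mult_ac)
      then show "form (C l) u u \<in> \<real>\<^sub>\<ge>\<^sub>0"
        using spec[OF B[unfolded positive_block_matrix_def], of "\<lambda>i. (T *v v i) $ l *s u"] by simp
    qed
    then have "\<rho> (C l) \<in> \<real>\<^sub>\<ge>\<^sub>0" for l
      using \<rho> by (simp add: positive_functional_def)
    then have "(\<Sum>l\<in>UNIV. \<rho> (C l)) \<in> \<real>\<^sub>\<ge>\<^sub>0"
      by (rule nn)
    also have "(\<Sum>l\<in>UNIV. \<rho> (C l)) = (\<Sum>i<k. \<Sum>j<k. \<Sum>l\<in>UNIV. cnj ((T *v v i) $ l) * (T *v v j) $ l * \<rho> (B i j))"
      unfolding C_def \<rho>sum lin by (subst sum.swap, rule sum.cong, rule refl, subst sum.swap, rule refl)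
    also have "\<dots> = (\<Sum>i<k. \<Sum>j<k. cinner (T *v v i) (T *v v j) * \<rho> (B i j))"
      by (simp add: cinner_def sum_distrib_right)
    also have "\<dots> = (\<Sum>i<k. \<Sum>j<k. cinner (v i) ((\<rho> (B i j) *\<^sub>C Q) *v v j))"
      by (simp add: Q[symmetric] form_def cscale_mult_vec cinner_scale_right mult.commute)
    also have "\<dots> = (\<Sum>i<k. cinner (v i) (\<Sum>j<k. (\<rho> (B i j) *\<^sub>C Q) *v v j))"
      by (simp add: cinner_sum_right)
    finally show "\<dots> \<in> \<real>\<^sub>\<ge>\<^sub>0" .
  qed
  then show ?thesis
    by (simp add: completely_positive_def matrix_map_linear_iff lin cscale_simps)
qed

section \<open>Resolvents\<close>

text \<open>
  A kernel vector for \<open>t > 0\<close> would be an eigenvector for \<open>- 1 / t\<close>; in finite dimension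
  injectivity is enough.
\<close>

lemma bij_id_plus_map:
  assumes lin: "matrix_map_linear \<psi>"
    and eig: "\<nexists>r::real. r < 0 \<and> matrix_map_eigenvalue \<psi> (complex_of_real r)"
    and t: "t \<ge> 0"
  shows "bij (\<lambda>A. A + t *\<^sub>R \<psi> A)"
proof -
  let ?g = "\<lambda>A. A + t *\<^sub>R \<psi> A"
  note l = matrix_map_linear_imp_linear[OF lin]
  have lg: "linear ?g"
    by (rule linearI) (simp_all add: linear_add[OF l] linear_scale[OF l] algebra_simps)
  have "A = 0" if "?g A = 0" for A
  proof (rule ccontr)
    assume A: "A \<noteq> 0"
    with that have "t \<noteq> 0" by auto
    have "\<psi> A = (1 / t) *\<^sub>R (t *\<^sub>R \<psi> A)" using \<open>t \<noteq> 0\<close> by simp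
    also have "t *\<^sub>R \<psi> A = - A" using that by (simp add: eq_neg_iff_add_eq_0 add.commute)
    finally have "\<psi> A = (- 1 / t) *\<^sub>R A" by simp
    then have "matrix_map_eigenvalue \<psi> (complex_of_real (- 1 / t))"
      using A unfolding matrix_map_eigenvalue_def scaleR_eq_cscale by blast
    moreover have "- 1 / t < 0" using t \<open>t \<noteq> 0\<close> by simp
    ultimately show False using eig by blast
  qed
  then have "inj ?g" using linear_injective_0[OF lg] by blast
  then show ?thesis using linear_injective_imp_surjective[OF lg] by (simp add: bij_def)
qed

lemma resolvent_map_eq:
  assumes "matrix_map_linear \<psi>"
    and "\<nexists>r::real. r < 0 \<and> matrix_map_eigenvalue \<psi> (complex_of_real r)"
    and "t \<ge> 0" and "X + t *\<^sub>R \<psi> X = A"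
  shows "resolvent_map t \<psi> A = \<psi> X"
  using inv_f_f[OF bij_is_inj[OF bij_id_plus_map[OF assms(1-3)]], of X] assms(4)
  by (simp add: resolvent_map_def)

text \<open>
  Here \<open>X = (I + t \<psi>)\<inverse> A\<close>: the resolvent takes values in the range of \<open>\<psi>\<close>, is related to the
  inverse by \<open>t \<psi> (I + t \<psi>)\<inverse> = I - (I + t \<psi>)\<inverse>\<close>, and commutes with \<open>\<psi>\<close>.
\<close>

lemma resolvent_map_decomposition:
  assumes "q_positive \<psi>" "t \<ge> 0"
  obtains X where "resolvent_map t \<psi> A = \<psi> X" "t *\<^sub>R resolvent_map t \<psi> A = A - X"
    "resolvent_map t \<psi> (\<psi> A) = \<psi> (resolvent_map t \<psi> A)"
proof -
  note q = assms(1)[unfolded q_positive_def]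
  note lin = conjunct1[OF q] and eig = conjunct1[OF conjunct2[OF q]]
  note l = matrix_map_linear_imp_linear[OF lin]
  obtain X where "A = X + t *\<^sub>R \<psi> X"
    using surjD[OF bij_is_surj[OF bij_id_plus_map[OF lin eig assms(2)]], of A] by blast
  then have X: "X + t *\<^sub>R \<psi> X = A" by (rule sym)
  have r: "resolvent_map t \<psi> A = \<psi> X" by (rule resolvent_map_eq[OF lin eig assms(2) X])
  have "\<psi> X + t *\<^sub>R \<psi> (\<psi> X) = \<psi> A"
    unfolding X[symmetric] by (simp add: linear_add[OF l] linear_scale[OF l])
  then have "resolvent_map t \<psi> (\<psi> A) = \<psi> (\<psi> X)" by (rule resolvent_map_eq[OF lin eig assms(2)])
  moreover have "t *\<^sub>R \<psi> X = A - X" using X by (simp add: algebra_simps)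
  ultimately show ?thesis using that[of X] r by simp
qed

text \<open>
  The range of \<open>\<rho>(\<cdot>) Q\<close> is spanned by \<open>Q\<close>, so its only possibly nonzero eigenvalue is \<open>\<rho>(Q)\<close>, and
  \<open>I + t \<rho>(\<cdot>) Q\<close> is inverted by subtracting a multiple of \<open>Q\<close>.
\<close>

lemma functional_map_resolvent:
  assumes \<rho>: "positive_functional \<rho>" and r: "\<rho> Q = complex_of_real r" "r \<ge> 0"
  shows "matrix_map_linear (\<lambda>A. \<rho> A *\<^sub>C Q)"
    and "\<nexists>s::real. s < 0 \<and> matrix_map_eigenvalue (\<lambda>A. \<rho> A *\<^sub>C Q) (complex_of_real s)"
    and "t \<ge> 0 \<Longrightarrow> resolvent_map t (\<lambda>A. \<rho> A *\<^sub>C Q) A = (complex_of_real (1 / (1 + t * r)) * \<rho> A) *\<^sub>C Q"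
proof -
  note lin = positive_functional_linear[OF \<rho>]
  show 1: "matrix_map_linear (\<lambda>A. \<rho> A *\<^sub>C Q)"
    by (simp add: matrix_map_linear_iff lin cscale_simps)
  show 2: "\<nexists>s::real. s < 0 \<and> matrix_map_eigenvalue (\<lambda>A. \<rho> A *\<^sub>C Q) (complex_of_real s)"
  proof
    assume "\<exists>s::real. s < 0 \<and> matrix_map_eigenvalue (\<lambda>A. \<rho> A *\<^sub>C Q) (complex_of_real s)"
    then obtain s A where s: "s < 0" and A: "A \<noteq> 0" and e: "\<rho> A *\<^sub>C Q = complex_of_real s *\<^sub>C A"
      by (auto simp: matrix_map_eigenvalue_def)
    have "\<rho> A * complex_of_real r = complex_of_real s * \<rho> A"
      using arg_cong[OF e, of \<rho>] by (simp add: lin r)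
    then have "\<rho> A = 0" using s r(2) by auto
    then have "complex_of_real s *\<^sub>C A = 0" using e by (simp add: cscale_simps)
    then have "A = 0" using s by (simp add: vec_eq_iff cscale_nth)
    then show False using A by simp
  qed
  assume t: "t \<ge> 0"
  define c where "c = complex_of_real (1 / (1 + t * r))"
  have "0 < 1 + t * r" using t r(2) by (simp add: add_pos_nonneg)
  then have c: "c + complex_of_real (t * r) * c = 1"
    unfolding c_def of_real_mult[symmetric] of_real_add[symmetric] by (simp add: field_simps flip: of_real_add)
  \<comment> \<open>The preimage of \<open>A\<close> under \<open>I + t \<rho>(\<cdot>) Q\<close>.\<close>
  define X where "X = A - (complex_of_real t * c * \<rho> A) *\<^sub>C Q"
  have "\<rho> X = \<rho> A * (1 - complex_of_real (t * r) * c)"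
    by (simp add: X_def lin r algebra_simps)
  also have "1 - complex_of_real (t * r) * c = c" using c by (simp add: diff_eq_eq)
  finally have X: "\<rho> X = c * \<rho> A" by (simp add: mult.commute)
  have "X + t *\<^sub>R (\<rho> X *\<^sub>C Q) = A"
    unfolding X by (simp add: X_def scaleR_eq_cscale cscale_simps mult.assoc)
  from resolvent_map_eq[OF 1 2 t this]
  show "resolvent_map t (\<lambda>A. \<rho> A *\<^sub>C Q) A = (complex_of_real (1 / (1 + t * r)) * \<rho> A) *\<^sub>C Q"
    by (simp add: X c_def)
qed

lemma q_positive_functional:
  fixes Q T :: "complex^'n^'n"
  assumes \<rho>: "positive_functional \<rho>" and r: "\<rho> Q = complex_of_real r" "r \<ge> 0"
    and Q: "\<And>u v. form Q u v = cinner (T *v u) (T *v v)"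
  shows "q_positive (\<lambda>A. \<rho> A *\<^sub>C Q)"
proof -
  have "completely_positive (resolvent_map t (\<lambda>A. \<rho> A *\<^sub>C Q))" if "t \<ge> 0" for t
  proof -
    have "resolvent_map t (\<lambda>A. \<rho> A *\<^sub>C Q) = (\<lambda>A. (complex_of_real (1 / (1 + t * r)) * \<rho> A) *\<^sub>C Q)"
      using functional_map_resolvent(3)[OF \<rho> r that] by blast
    then show ?thesis
      using completely_positive_functional[OF positive_functional_scale[OF \<rho>, of "1 / (1 + t * r)"] Q]
        that r(2) by simp
  qed
  then show ?thesis
    using functional_map_resolvent(1,2)[OF \<rho> r] by (simp add: q_positive_def)
qed

lemma form_mat_1_factor: "form (mat 1) u v = cinner (mat 1 *v u) (mat 1 *v v)"
  by (simp add: form_simps)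

section \<open>Multiples of the map given by a state\<close>

context
  fixes \<rho> :: "complex^'n^'n \<Rightarrow> complex"
  assumes state: "state \<rho>"
begin

lemma state_functional: "positive_functional \<rho>" and state_1: "\<rho> (mat 1) = 1"
  using state by (auto simp: state_def positive_functional_def)

lemma state_multiple_resolvent:
  assumes "d \<ge> 0" "t \<ge> 0"
  shows "resolvent_map t (\<lambda>A. (complex_of_real d * \<rho> A) *\<^sub>C mat 1) =
    (\<lambda>A. (complex_of_real (d / (1 + t * d)) * \<rho> A) *\<^sub>C mat 1)"
  using functional_map_resolvent(3)[OF positive_functional_scale[OF state_functional assms(1)] _ assms]
  by (simp add: state_1 fun_eq_iff)

lemma state_multiple_q_positive:
  assumes "d \<ge> 0"
  shows "q_positive (\<lambda>A. (complex_of_real d * \<rho> A) *\<^sub>C mat 1)"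
  using assms
  by (intro q_positive_functional[OF positive_functional_scale[OF state_functional] _ _ form_mat_1_factor])
    (simp_all add: state_1)

lemma state_map_eq_multiple: "(\<lambda>A. \<rho> A *\<^sub>C mat 1) = (\<lambda>A. (complex_of_real 1 * \<rho> A) *\<^sub>C mat 1)"
  by simp

text \<open>
  The inequality behind this is that \<open>d / (1 + t d)\<close> is increasing in \<open>d \<ge> 0\<close>.
\<close>

lemma state_multiple_subordinate:
  assumes d: "0 \<le> d" "d \<le> 1"
  shows "(\<lambda>A. \<rho> A *\<^sub>C mat 1) \<ge>\<^sub>q (\<lambda>A. (complex_of_real d * \<rho> A) *\<^sub>C mat 1)"
  unfolding q_subordinate_def
proof (intro conjI allI impI)
  show "q_positive (\<lambda>A. \<rho> A *\<^sub>C mat 1)" using state_multiple_q_positive[of 1] by simp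
  show "q_positive (\<lambda>A. (complex_of_real d * \<rho> A) *\<^sub>C mat 1)" using d by (simp add: state_multiple_q_positive)
  fix t :: real assume t: "t \<ge> 0"
  define e where "e = 1 / (1 + t) - d / (1 + t * d)"
  have "0 < 1 + t * d" "0 < 1 + t" using t d by (simp_all add: add_pos_nonneg)
  then have "e \<ge> 0" using d t by (simp add: e_def field_simps)
  then have "completely_positive (\<lambda>A. (complex_of_real e * \<rho> A) *\<^sub>C mat 1)"
    by (intro completely_positive_functional[OF positive_functional_scale[OF state_functional] form_mat_1_factor])
  also have "(\<lambda>A. (complex_of_real e * \<rho> A) *\<^sub>C mat 1) =
     (\<lambda>A. resolvent_map t (\<lambda>A. \<rho> A *\<^sub>C mat 1) A - resolvent_map t (\<lambda>A. (complex_of_real d * \<rho> A) *\<^sub>C mat 1) A)"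
    using t d unfolding state_map_eq_multiple
    by (simp add: state_multiple_resolvent e_def left_diff_distrib cscale_simps del: of_real_1)
  finally show "completely_positive \<dots>" .
qed

text \<open>
  The parameters correspond by \<open>d = 1 / (1 + s)\<close>, and the zero map is the missing endpoint \<open>d = 0\<close>.
\<close>

lemma state_multiples_eq:
  "{\<lambda>A. 0} \<union> {resolvent_map s (\<lambda>A. \<rho> A *\<^sub>C mat 1) | s. s \<ge> 0} =
    {(\<lambda>A. (complex_of_real d * \<rho> A) *\<^sub>C mat 1) | d. 0 \<le> d \<and> d \<le> 1}"
proof -
  have res: "resolvent_map s (\<lambda>A. \<rho> A *\<^sub>C mat 1) = (\<lambda>A. (complex_of_real (1 / (1 + s)) * \<rho> A) *\<^sub>C mat 1)"
    if "s \<ge> 0" for s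
    using state_multiple_resolvent[of 1 s] that by simp
  have zero: "(\<lambda>A. 0) = (\<lambda>A. (complex_of_real 0 * \<rho> A) *\<^sub>C (mat 1 :: complex^'n^'n))"
    by (simp add: cscale_simps)
  show ?thesis
  proof (intro set_eqI iffI)
    fix \<psi> :: "complex^'n^'n \<Rightarrow> complex^'n^'n"
    assume "\<psi> \<in> {\<lambda>A. 0} \<union> {resolvent_map s (\<lambda>A. \<rho> A *\<^sub>C mat 1) | s. s \<ge> 0}"
    then consider "\<psi> = (\<lambda>A. 0)" | s where "s \<ge> 0" "\<psi> = resolvent_map s (\<lambda>A. \<rho> A *\<^sub>C mat 1)" by blast
    then show "\<psi> \<in> {(\<lambda>A. (complex_of_real d * \<rho> A) *\<^sub>C mat 1) | d. 0 \<le> d \<and> d \<le> 1}"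
    proof cases
      case 1
      then show ?thesis using zero by (intro CollectI exI[of _ 0]) simp
    next
      case 2
      then show ?thesis using res by (intro CollectI exI[of _ "1 / (1 + s)"]) simp
    qed
  next
    fix \<psi> :: "complex^'n^'n \<Rightarrow> complex^'n^'n"
    assume "\<psi> \<in> {(\<lambda>A. (complex_of_real d * \<rho> A) *\<^sub>C mat 1) | d. 0 \<le> d \<and> d \<le> 1}"
    then obtain d where d: "0 \<le> d" "d \<le> 1" and \<psi>: "\<psi> = (\<lambda>A. (complex_of_real d * \<rho> A) *\<^sub>C mat 1)" by blast
    show "\<psi> \<in> {\<lambda>A. 0} \<union> {resolvent_map s (\<lambda>A. \<rho> A *\<^sub>C mat 1) | s. s \<ge> 0}"
    proof (cases "d = 0")
      case True
      then show ?thesis using zero \<psi> by simp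
    next
      case False
      then have "\<psi> = resolvent_map (1 / d - 1) (\<lambda>A. \<rho> A *\<^sub>C mat 1)" "1 / d - 1 \<ge> 0"
        using res[of "1 / d - 1"] \<psi> d by simp_all
      then show ?thesis by blast
    qed
  qed
qed

section \<open>States that are not faithful\<close>

lemma not_faithful_rank_one:
  assumes "\<not> faithful \<rho>"
  obtains w where "w \<noteq> 0" "\<rho> (rank_one w w) = 0"
proof -
  note lin = positive_functional_linear[OF state_functional]
  obtain A where A: "positive_matrix A" "\<rho> A = 0" "A \<noteq> 0"
    using assms by (auto simp: faithful_def)
  then obtain v where v: "form A v v \<noteq> 0" using matrix_eq_0_if_form by blast
  have "\<rho> (form A v v *\<^sub>C A - rank_one (A *v v) (A *v v)) \<in> \<real>\<^sub>\<ge>\<^sub>0"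
    and "\<rho> (rank_one (A *v v) (A *v v)) \<in> \<real>\<^sub>\<ge>\<^sub>0"
    using state_functional rank_one_le[OF A(1) v] positive_rank_one by (auto simp: positive_functional_def)
  then have "\<rho> (rank_one (A *v v) (A *v v)) = 0"
    by (simp add: lin A complex_nonneg_Reals_iff complex_eq_iff)
  moreover have "A *v v \<noteq> 0" using v by (auto simp: form_def cinner_zero_right)
  ultimately show ?thesis using that by blast
qed

text \<open>
  With \<open>P\<close> the projection onto a vector \<open>w\<close> such that \<open>\<rho>(w w\<^sup>*) = 0\<close>, the witness is
  \<open>\<rho>(\<cdot>) (I - P)\<close>. Its resolvents have the same scalar factor as those of \<open>\<rho>(\<cdot>) I\<close> because \<open>\<rho>(P) = 0\<close>.
\<close>

lemma not_faithful_subordinate: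
  assumes "\<not> faithful \<rho>"
  shows "\<exists>\<psi>. (\<lambda>A. \<rho> A *\<^sub>C mat 1) \<ge>\<^sub>q \<psi> \<and> (\<forall>d. \<psi> \<noteq> (\<lambda>A. (complex_of_real d * \<rho> A) *\<^sub>C mat 1))"
proof -
  note lin = positive_functional_linear[OF state_functional]
  obtain w where w: "w \<noteq> 0" "\<rho> (rank_one w w) = 0" using not_faithful_rank_one[OF assms] .
  define n where "n = cinner w w"
  have n: "n \<noteq> 0" "cnj n = n"
    using w by (simp_all add: n_def cinner_self_eq_0 cnj_cinner)
  define P Q where "P = (1 / n) *\<^sub>C rank_one w w" and "Q = mat 1 - P"
  have Pv: "P *v v = (cinner w v / n) *s w" for v
    by (simp add: P_def cscale_mult_vec rank_one_mult_vec)
  have Qv: "Q *v v = v - (cinner w v / n) *s w" for v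
    by (simp add: Q_def matrix_vector_mult_diff_rdistrib Pv)
  have P: "form P u v = cinner (P *v u) (P *v v)" for u v
    using n cnj_cinner[of w u] unfolding Pv
    by (simp add: P_def form_simps form_rank_one cinner_scale_left cinner_scale_right n_def[symmetric] field_simps)
  have Q: "form Q u v = cinner (Q *v u) (Q *v v)" for u v
    using n cnj_cinner[of w u] unfolding Qv
    by (simp add: Q_def P_def form_simps form_rank_one cinner_scale_left cinner_scale_right cinner_diff_left
        cinner_diff_right n_def[symmetric] field_simps)
  have \<rho>Q: "\<rho> Q = 1" by (simp add: Q_def P_def lin w state_1)
  let ?\<psi> = "\<lambda>A. \<rho> A *\<^sub>C Q"
  have "(\<lambda>A. \<rho> A *\<^sub>C mat 1) \<ge>\<^sub>q ?\<psi>"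
    unfolding q_subordinate_def
  proof (intro conjI allI impI)
    show "q_positive (\<lambda>A. \<rho> A *\<^sub>C mat 1)" using state_multiple_q_positive[of 1] by simp
    show "q_positive ?\<psi>" using \<rho>Q by (intro q_positive_functional[OF state_functional _ _ Q, of 1]) simp_all
    fix t :: real assume t: "t \<ge> 0"
    have "completely_positive (\<lambda>A. (complex_of_real (1 / (1 + t)) * \<rho> A) *\<^sub>C P)"
      using t by (intro completely_positive_functional[OF positive_functional_scale[OF state_functional] P]) simp
    also have "(\<lambda>A. (complex_of_real (1 / (1 + t)) * \<rho> A) *\<^sub>C P) =
        (\<lambda>A. resolvent_map t (\<lambda>A. \<rho> A *\<^sub>C mat 1) A - resolvent_map t ?\<psi> A)"
      using functional_map_resolvent(3)[OF state_functional, of Q 1 t]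
        functional_map_resolvent(3)[OF state_functional, of "mat 1" 1 t] t \<rho>Q state_1
      by (simp add: Q_def cscale_simps)
    finally show "completely_positive \<dots>" .
  qed
  moreover have "?\<psi> \<noteq> (\<lambda>A. (complex_of_real d * \<rho> A) *\<^sub>C mat 1)" for d
  proof
    assume "?\<psi> = (\<lambda>A. (complex_of_real d * \<rho> A) *\<^sub>C mat 1)"
    from fun_cong[OF this, of "mat 1"] have Qd: "Q = complex_of_real d *\<^sub>C mat 1"
      by (simp add: state_1 cscale_simps)
    have "form Q w w = 0"
      using n by (simp add: Q_def P_def form_simps form_rank_one n_def[symmetric])
    then have "d = 0" using n by (simp add: Qd form_simps n_def)
    then show False using \<rho>Q Qd by (simp add: lin)
  qed
  ultimately show ?thesis by blast
qed

section \<open>Subordinates of faithful states\<close>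

text \<open>
  The maps \<open>L k\<close> below are the approximations \<open>k \<psi>\<^sup>(\<^sup>k\<^sup>)\<close> to the projection onto the range of \<open>\<psi>\<close>, and
  \<open>D k\<close> is the positive defect \<open>k \<phi>\<^sup>(\<^sup>k\<^sup>) - L k\<close>. The limit \<open>M\<close> of \<open>L k I\<close> along a subsequence is
  shown to be \<open>0\<close> or \<open>I\<close>, and each case determines \<open>\<psi>\<close>.
\<close>

lemma faithful_subordinate:
  assumes faithful: "faithful \<rho>" and sub: "(\<lambda>A. \<rho> A *\<^sub>C mat 1) \<ge>\<^sub>q \<psi>"
  shows "\<exists>d. 0 \<le> d \<and> d \<le> 1 \<and> \<psi> = (\<lambda>A. (complex_of_real d * \<rho> A) *\<^sub>C mat 1)"
proof -
  note lin = positive_functional_linear[OF state_functional]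
  have qp: "q_positive \<psi>" using sub by (simp add: q_subordinate_def)
  then have mlin: "matrix_map_linear \<psi>" by (simp add: q_positive_def)
  note l = matrix_map_linear_imp_linear[OF mlin]
  have \<psi>_tendsto: "(\<lambda>k. \<psi> (X k)) \<longlonglongrightarrow> \<psi> A" if "X \<longlonglongrightarrow> A" for X :: "nat \<Rightarrow> _" and A
    using bounded_linear.tendsto[OF _ that] l by (simp add: linear_conv_bounded_linear)
  define S where "S k = resolvent_map (real k) \<psi>" for k
  define L where "L k A = real k *\<^sub>R S k A" for k A
  define e where "e k = real k / (1 + real k)" for k
  define D where "D k A = (complex_of_real (e k) * \<rho> A) *\<^sub>C mat 1 - L k A" for k A
  have scale: "positive_map (\<lambda>A. c *\<^sub>R F A)" if "positive_map F" "c \<ge> 0" for F :: "complex^'n^'n \<Rightarrow> complex^'n^'n" and c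
    using that by (auto simp: positive_map_def matrix_map_linear_iff scaleR_eq_cscale cscale_simps mult.commute
        positive_matrix_scale)
  have res: "resolvent_map (real k) (\<lambda>A. \<rho> A *\<^sub>C mat 1) A = (complex_of_real (1 / (1 + real k)) * \<rho> A) *\<^sub>C mat 1" for k A
    using functional_map_resolvent(3)[OF state_functional, of "mat 1" 1 "real k" A] state_1 by simp
  have S_pos: "positive_map (S k)" for k
    using qp by (auto simp: S_def q_positive_def intro: completely_positive_imp_positive)
  have d_pos: "positive_map (\<lambda>A. (complex_of_real (1 / (1 + real k)) * \<rho> A) *\<^sub>C mat 1 - S k A)" for k
    using sub completely_positive_imp_positive[of "\<lambda>A. resolvent_map (real k) (\<lambda>A. \<rho> A *\<^sub>C mat 1) A - S k A"]
    unfolding res[symmetric] by (simp add: q_subordinate_def S_def)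
  have L_pos: "positive_map (L k)" for k
    unfolding L_def by (intro scale S_pos) simp
  have D_eq: "D k = (\<lambda>A. real k *\<^sub>R ((complex_of_real (1 / (1 + real k)) * \<rho> A) *\<^sub>C mat 1 - S k A))" for k
    by (simp add: fun_eq_iff vec_eq_iff cscale_nth D_def L_def e_def scaleR_conv_of_real[where 'a = complex]
        right_diff_distrib)
  have D_pos: "positive_map (D k)" for k
    unfolding D_eq by (intro scale d_pos) simp
  have 0: "(\<lambda>k. 1 / (1 + real k)) \<longlonglongrightarrow> 0"
    using LIMSEQ_inverse_real_of_nat by (simp add: inverse_eq_divide add.commute)
  have e1: "e \<longlonglongrightarrow> 1"
  proof -
    have "1 + real k \<noteq> 0" for k by linarith
    then have "e = (\<lambda>k. 1 - 1 / (1 + real k))" by (simp add: e_def fun_eq_iff diff_divide_eq_iff)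
    then show ?thesis using tendsto_diff[OF tendsto_const 0, of 1] by simp
  qed

  \<comment> \<open>\<open>S k\<close> lies below \<open>\<phi>\<^sup>(\<^sup>k\<^sup>) = \<rho>(\<cdot>) I / (1 + k)\<close>.\<close>
  have S_0: "(\<lambda>k. S k A) \<longlonglongrightarrow> 0" for A
  proof (rule positive_maps_tendsto_0[OF S_pos])
    show "(\<lambda>k. S k (mat 1)) \<longlonglongrightarrow> 0"
    proof (rule positive_squeeze)
      show "positive_matrix (S k (mat 1))" for k using S_pos by (simp add: positive_mat_1 positive_map_def)
      show "positive_matrix ((1 / (1 + real k)) *\<^sub>R mat 1 - S k (mat 1))" for k
      proof -
        have "positive_matrix ((complex_of_real (1 / (1 + real k)) * \<rho> (mat 1)) *\<^sub>C mat 1 - S k (mat 1))"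
          using d_pos[of k] positive_mat_1 unfolding positive_map_def by blast
        then show ?thesis unfolding state_1 scaleR_eq_cscale by simp
      qed
      show "(\<lambda>k. (1 / (1 + real k)) *\<^sub>R (mat 1 :: complex^'n^'n)) \<longlonglongrightarrow> 0"
        using tendsto_scaleR[OF 0 tendsto_const[of "mat 1 :: complex^'n^'n"]] by (simp only: scaleR_zero_left)
    qed
  qed
  have L_\<psi>: "L k (\<psi> A) = \<psi> (L k A)" "L k (\<psi> A) = \<psi> A - S k A" "\<exists>X. S k A = \<psi> X" for k A
  proof -
    obtain X where X: "resolvent_map k \<psi> A = \<psi> X" "real k *\<^sub>R resolvent_map k \<psi> A = A - X"
      "resolvent_map k \<psi> (\<psi> A) = \<psi> (resolvent_map k \<psi> A)"
      using resolvent_map_decomposition[OF qp, of "real k" A] by auto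
    show "L k (\<psi> A) = \<psi> (L k A)" using X(3) by (simp add: L_def S_def linear_scale[OF l])
    also have "\<dots> = \<psi> (A - X)" using X(2) by (simp add: L_def S_def)
    finally show "L k (\<psi> A) = \<psi> A - S k A" using X(1) by (simp add: S_def linear_diff[OF l])
    show "\<exists>X. S k A = \<psi> X" using X(1) by (auto simp: S_def)
  qed
  have L_range: "(\<lambda>k. L k (\<psi> A)) \<longlonglongrightarrow> \<psi> A" for A
    using tendsto_diff[OF tendsto_const S_0, of "\<psi> A" A] by (simp add: L_\<psi>(2))

  have L1: "positive_matrix (L k (mat 1))" "positive_matrix (mat 1 - L k (mat 1))" for k
  proof -
    show "positive_matrix (L k (mat 1))" using L_pos by (simp add: positive_mat_1 positive_map_def)
    have "mat 1 - L k (mat 1) = D k (mat 1) + complex_of_real (1 - e k) *\<^sub>C mat 1"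
      by (simp add: D_def state_1 cscale_simps)
    moreover have "positive_matrix (D k (mat 1))" using D_pos by (simp add: positive_mat_1 positive_map_def)
    moreover have "positive_matrix (complex_of_real (1 - e k) *\<^sub>C (mat 1 :: complex^'n^'n))"
      by (rule positive_matrix_scale[OF positive_mat_1]) (simp add: e_def field_simps complex_nonneg_Reals_iff)
    ultimately show "positive_matrix (mat 1 - L k (mat 1))"
      by (simp only: positive_matrix_add)
  qed
  have "bounded (range (\<lambda>k. L k (mat 1)))"
    unfolding bounded_iff using norm_le_if_le_mat_1[OF L1] by blast
  then obtain M r where r: "strict_mono r" and "((\<lambda>k. L k (mat 1)) \<circ> r) \<longlonglongrightarrow> M"
    using bounded_imp_convergent_subsequence[of "\<lambda>k. L k (mat 1)"] by blast
  then have M: "(\<lambda>k. L (r k) (mat 1)) \<longlonglongrightarrow> M" by (simp add: o_def)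
  note sub_lim = LIMSEQ_subseq_LIMSEQ[OF _ r, unfolded o_def]
  \<comment> \<open>The range of \<open>\<psi>\<close> is closed and contains each \<open>L k I\<close>, so it contains \<open>M\<close>, where \<open>L k\<close> tends
    to the identity along the whole sequence.\<close>
  have "closed (range \<psi>)"
    by (rule closed_subspace) (rule linear_subspace_image[OF l subspace_UNIV])
  moreover have "L k (mat 1) \<in> range \<psi>" for k
  proof -
    obtain X where "S k (mat 1) = \<psi> X" using L_\<psi>(3) by blast
    then have "L k (mat 1) = \<psi> (real k *\<^sub>R X)" by (simp add: L_def linear_scale[OF l])
    then show ?thesis by blast
  qed
  ultimately have "M \<in> range \<psi>" using closed_sequentially[OF _ _ M] by blast
  then have LM: "(\<lambda>k. L k M) \<longlonglongrightarrow> M" using L_range by auto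
  have M_pos: "positive_matrix M" using positive_matrix_tendsto[OF M] L1 by blast
  have M_le: "positive_matrix (mat 1 - M)"
    using positive_matrix_tendsto[OF tendsto_diff[OF tendsto_const M]] L1 by blast
  have D_tendsto: "(\<lambda>k. D k A) \<longlonglongrightarrow> \<rho> A *\<^sub>C mat 1 - B" if "(\<lambda>k. L k A) \<longlonglongrightarrow> B" for A B
  proof -
    have "(\<lambda>k. e k *\<^sub>R (\<rho> A *\<^sub>C mat 1) - L k A) \<longlonglongrightarrow> 1 *\<^sub>R (\<rho> A *\<^sub>C mat 1) - B"
      by (intro tendsto_intros e1 that)
    then show ?thesis by (simp add: D_def scaleR_eq_cscale[of _ "_ *\<^sub>C _"] cscale_simps)
  qed
  \<comment> \<open>The limit of \<open>D k M \<ge> 0\<close> is \<open>M \<le> \<rho>(M) I\<close>; applying \<open>L (r k)\<close> and taking the limit again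
    replaces \<open>I\<close> by \<open>M\<close>.\<close>
  have "positive_matrix (\<rho> M *\<^sub>C mat 1 - M)"
    using positive_matrix_tendsto[OF D_tendsto[OF LM]] D_pos M_pos by (simp add: positive_map_def)
  then have "positive_matrix (L (r k) (\<rho> M *\<^sub>C mat 1) - L (r k) M)" for k
    using positive_map_mono[OF L_pos] by blast
  moreover have "(\<lambda>k. L (r k) (\<rho> M *\<^sub>C mat 1) - L (r k) M) \<longlonglongrightarrow> \<rho> M *\<^sub>C M - M"
  proof -
    have L': "L k (c *\<^sub>C A) = c *\<^sub>C L k A" for k c A
      using L_pos by (simp add: positive_map_def matrix_map_linear_iff)
    have "(\<lambda>k. \<rho> M *\<^sub>C L (r k) (mat 1)) \<longlonglongrightarrow> \<rho> M *\<^sub>C M"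
      by (rule tendsto_cscale[OF M])
    then show ?thesis unfolding L' by (intro tendsto_diff sub_lim[OF LM])
  qed
  ultimately have M_M: "positive_matrix (\<rho> M *\<^sub>C M - M)" using positive_matrix_tendsto by blast
  \<comment> \<open>Faithfulness enters here: if \<open>M \<noteq> I\<close> then \<open>\<rho>(M) < 1\<close>, which \<open>M \<le> \<rho>(M) M\<close> permits for \<open>M = 0\<close>
    only.\<close>
  have M_cases: "M = 0 \<or> M = mat 1"
  proof (rule disjCI)
    assume "M \<noteq> mat 1"
    then have "mat 1 - M \<noteq> 0" by simp
    with M_le faithful have "\<rho> (mat 1 - M) \<noteq> 0" by (auto simp: faithful_def)
    moreover have "\<rho> (mat 1 - M) \<in> \<real>\<^sub>\<ge>\<^sub>0" using M_le state_functional by (simp add: positive_functional_def)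
    ultimately have \<rho>M: "Re (\<rho> M) < 1" "Im (\<rho> M) = 0"
      by (auto simp: lin state_1 complex_nonneg_Reals_iff complex_eq_iff)
    show "M = 0"
    proof (rule matrix_eq_0_if_form)
      fix v
      have "form M v v \<in> \<real>\<^sub>\<ge>\<^sub>0" "\<rho> M * form M v v - form M v v \<in> \<real>\<^sub>\<ge>\<^sub>0"
        using M_pos M_M by (auto simp: positive_matrix_form form_simps)
      then have "Re (form M v v) \<ge> 0" "Im (form M v v) = 0" "(Re (\<rho> M) - 1) * Re (form M v v) \<ge> 0"
        by (auto simp: complex_nonneg_Reals_iff \<rho>M algebra_simps)
      then show "form M v v = 0"
        using \<rho>M by (auto simp: complex_eq_iff zero_le_mult_iff)
    qed
  qed
  show ?thesis
  proof (cases "M = 0")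
    case True
    have "\<psi> A = 0" for A
      using LIMSEQ_unique[OF sub_lim[OF L_range] positive_maps_tendsto_0[of "\<lambda>k. L (r k)"]] L_pos M True by blast
    then show ?thesis by (intro exI[of _ 0]) (auto simp: cscale_simps)
  next
    case False
    then have M1: "M = mat 1" using M_cases by simp
    have D1: "(\<lambda>k. D (r k) A) \<longlonglongrightarrow> 0" for A
    proof (rule positive_maps_tendsto_0[of "\<lambda>k. D (r k)"])
      have "(\<lambda>k. e (r k) *\<^sub>R mat 1 - L (r k) (mat 1)) \<longlonglongrightarrow> 1 *\<^sub>R mat 1 - mat 1"
        by (intro tendsto_intros sub_lim[OF e1] M[unfolded M1])
      then show "(\<lambda>k. D (r k) (mat 1)) \<longlonglongrightarrow> 0" by (simp add: D_def state_1 scaleR_eq_cscale cscale_simps)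
    qed (rule D_pos)
    have L\<rho>: "(\<lambda>k. L (r k) A) \<longlonglongrightarrow> \<rho> A *\<^sub>C mat 1" for A
    proof -
      have "(\<lambda>k. e (r k) *\<^sub>R (\<rho> A *\<^sub>C mat 1) - D (r k) A) \<longlonglongrightarrow> 1 *\<^sub>R (\<rho> A *\<^sub>C mat 1) - 0"
        by (intro tendsto_intros sub_lim[OF e1] D1)
      then show ?thesis by (simp add: D_def scaleR_eq_cscale[of _ "_ *\<^sub>C _"] cscale_simps)
    qed
    \<comment> \<open>Both \<open>L (r k) (\<psi> A)\<close> and \<open>\<psi> (L (r k) A)\<close> tend to \<open>\<psi> A\<close>; their limits can also be computed
      from \<open>L (r k) \<rightarrow> \<phi>\<close>.\<close>
    have 1: "\<psi> A = \<rho> (\<psi> A) *\<^sub>C mat 1" for A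
      using LIMSEQ_unique[OF sub_lim[OF L_range] L\<rho>] .
    have 2: "\<psi> A = \<rho> A *\<^sub>C \<psi> (mat 1)" for A
    proof -
      have "(\<lambda>k. \<psi> (L (r k) A)) \<longlonglongrightarrow> \<psi> (\<rho> A *\<^sub>C mat 1)" by (rule \<psi>_tendsto[OF L\<rho>])
      then have "(\<lambda>k. L (r k) (\<psi> A)) \<longlonglongrightarrow> \<psi> (\<rho> A *\<^sub>C mat 1)" by (simp add: L_\<psi>(1))
      from LIMSEQ_unique[OF sub_lim[OF L_range] this] show ?thesis
        using mlin by (simp add: matrix_map_linear_iff cscale_simps)
    qed
    \<comment> \<open>The scalar is bounded by the order relation at parameter \<open>0\<close>, where the resolvent is the map itself.\<close>
    have S0: "S 0 = \<psi>" by (auto simp: S_def resolvent_map_def inv_id[unfolded id_def])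
    define c where "c = \<rho> (\<psi> (mat 1))"
    have "positive_matrix (\<psi> (mat 1))"
      using S_pos[of 0] positive_mat_1 unfolding S0 positive_map_def by blast
    moreover have "positive_map (\<lambda>A. \<rho> A *\<^sub>C mat 1 - \<psi> A)" using d_pos[of 0] by (simp add: S0)
    then have "positive_matrix (\<rho> (mat 1) *\<^sub>C mat 1 - \<psi> (mat 1))"
      using positive_mat_1 unfolding positive_map_def by blast
    then have "positive_matrix (mat 1 - \<psi> (mat 1))" by (simp add: state_1 cscale_simps)
    ultimately have "\<rho> (\<psi> (mat 1)) \<in> \<real>\<^sub>\<ge>\<^sub>0" "\<rho> (mat 1 - \<psi> (mat 1)) \<in> \<real>\<^sub>\<ge>\<^sub>0"
      using state_functional unfolding positive_functional_def by blast+
    then have "c \<in> \<real>\<^sub>\<ge>\<^sub>0" "1 - c \<in> \<real>\<^sub>\<ge>\<^sub>0" by (simp_all add: c_def lin state_1)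
    then have "0 \<le> Re c \<and> Re c \<le> 1 \<and> c = complex_of_real (Re c)"
      by (simp add: complex_nonneg_Reals_iff complex_eq_iff)
    then obtain d where "0 \<le> d" "d \<le> 1" "c = complex_of_real d" by blast
    moreover have "\<psi> A = (c * \<rho> A) *\<^sub>C mat 1" for A
    proof -
      have "\<psi> A = \<rho> A *\<^sub>C c *\<^sub>C mat 1" using 2[of A] 1[of "mat 1"] by (simp only: c_def)
      then show ?thesis by (simp add: cscale_simps mult.commute)
    qed
    ultimately show ?thesis by (intro exI[of _ d]) (simp add: fun_eq_iff)
  qed
qed

end

theorem proposition5p2:
  fixes \<rho> :: "complex^'n^'n \<Rightarrow> complex"
    and \<phi> :: "complex^'n^'n \<Rightarrow> complex^'n^'n"
  assumes "state \<rho>"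
    and "\<And>A. \<phi> A = \<rho> A *\<^sub>C mat 1"
  shows "q_positive \<phi> \<and> (q_pure \<phi> \<longleftrightarrow> faithful \<rho>)"
proof -
  have \<phi>: "\<phi> = (\<lambda>A. \<rho> A *\<^sub>C mat 1)" using assms(2) by blast
  have q: "q_positive \<phi>" using state_multiple_q_positive[OF assms(1), of 1] by (simp add: \<phi>)
  have "q_pure \<phi> \<longleftrightarrow>
      {\<psi>. \<phi> \<ge>\<^sub>q \<psi>} = {(\<lambda>A. (complex_of_real d * \<rho> A) *\<^sub>C mat 1) | d. 0 \<le> d \<and> d \<le> 1}"
    using q state_1[OF assms(1)] unfolding q_pure_def \<phi> state_multiples_eq[OF assms(1)]
    by (simp add: cscale_simps)
  also have "\<dots> \<longleftrightarrow> faithful \<rho>"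
  proof
    assume "{\<psi>. \<phi> \<ge>\<^sub>q \<psi>} = {(\<lambda>A. (complex_of_real d * \<rho> A) *\<^sub>C mat 1) | d. 0 \<le> d \<and> d \<le> 1}"
    then show "faithful \<rho>" using not_faithful_subordinate[OF assms(1)] unfolding \<phi> by blast
  next
    assume "faithful \<rho>"
    then show "{\<psi>. \<phi> \<ge>\<^sub>q \<psi>} = {(\<lambda>A. (complex_of_real d * \<rho> A) *\<^sub>C mat 1) | d. 0 \<le> d \<and> d \<le> 1}"
      using faithful_subordinate[OF assms(1)] state_multiple_subordinate[OF assms(1)] unfolding \<phi> by blast
  qed
  finally show ?thesis using q by blast
qed

end
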